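(* Every nontrivial simple group $G$ (commutative or noncommutative, finite or infinite) is Rhodes-prime with respect to semidirect products in the category of all groups. Hence every nontrivial finite simple group $G$ is Rhodes-prime with respect to semidirect products in the category of finite groups.
   Context: A group is nontrivial if it has more than one element. $H$ is a subquotient of a group $G$ if $H$ is isomorphic to a homomorphic image of a subgroup of $G$. Working in the category of all groups (respectively, of finite groups), a nontrivial group $G$ in the category is Rhodes-prime with respect to semidirect products if, whenever $G$ is a subquotient of a group in the category that can be written as a semidirect product $G_0\rtimes G_1$ (with $G_0$ the normal factor), then $G$ is a subquotient of one of $G_0$ or $G_1$. *)

theory Defs
  imports "HOL-Algebra.Algebra"
begin

definition nontrivial_group :: "'a monoid \<Rightarrow> bool" where
  "nontrivial_group G \<longleftrightarrow> group G \<and> (\<exists>x\<in>carrier G. \<exists>y\<in>carrier G. x \<noteq> y)"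

text \<open>
  The library locale \<open>simple_group\<close> demands \<open>order G > 1\<close>; since \<open>order\<close> is a cardinality
  of type \<open>nat\<close>, with value \<open>0\<close> on infinite carriers, that locale excludes infinite groups.
  The trivial group is not excluded here; this is left to \<open>nontrivial_group\<close>.
\<close>
definition simple_grp :: "'a monoid \<Rightarrow> bool" where
  "simple_grp G \<longleftrightarrow> group G \<and> (\<forall>N. N \<lhd> G \<longrightarrow> N = {\<one>\<^bsub>G\<^esub>} \<or> N = carrier G)"

lemma finite_simple_grp_iff:
  assumes "finite (carrier G)"
  shows "nontrivial_group G \<and> simple_grp G \<longleftrightarrow> simple_group G"
proof -
  have "(\<exists>x\<in>carrier G. \<exists>y\<in>carrier G. x \<noteq> y) \<longleftrightarrow> order G > 1"
    using assms card_le_Suc0_iff_eq[OF assms] by (fastforce simp: order_def not_le[symmetric])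
  then show ?thesis
    unfolding nontrivial_group_def simple_grp_def simple_group_def simple_group_axioms_def
    by blast
qed

text \<open>
  The homomorphic image \<open>K\<close> is only needed up to isomorphism with \<open>G\<close>, so letting it range over
  groups on the element type of \<open>G\<close> is no restriction.
\<close>
definition subquotient :: "'a monoid \<Rightarrow> 'b monoid \<Rightarrow> bool" where
  "subquotient G H \<longleftrightarrow>
     (\<exists>S (K :: 'a monoid) f. subgroup S H \<and> group K \<and> f \<in> epi (H\<lparr>carrier := S\<rparr>) K \<and> G \<cong> K)"

definition semidirect_product ::
    "'b monoid \<Rightarrow> 'c monoid \<Rightarrow> ('c \<Rightarrow> 'b \<Rightarrow> 'b) \<Rightarrow> ('b \<times> 'c) monoid" where
  "semidirect_product G0 G1 \<phi> =
     \<lparr>carrier = carrier G0 \<times> carrier G1,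
      monoid.mult = (\<lambda>(a, x) (b, y). (a \<otimes>\<^bsub>G0\<^esub> \<phi> x b, x \<otimes>\<^bsub>G1\<^esub> y)),
      monoid.one = (\<one>\<^bsub>G0\<^esub>, \<one>\<^bsub>G1\<^esub>)\<rparr>"

lemma group_semidirect_product:
  assumes "group G0" "group G1" "\<phi> \<in> hom G1 (AutoGroup G0)"
  shows "group (semidirect_product G0 G1 \<phi>)"
proof -
  interpret G0: group G0 by fact
  interpret G1: group G1 by fact
  interpret A: group "AutoGroup G0" by (rule G0.AutoGroup)
  interpret \<phi>: group_hom G1 "AutoGroup G0" \<phi> by unfold_locales fact
  have cl: "\<phi> x \<in> auto G0" if "x \<in> carrier G1" for x
    using \<phi>.hom_closed[OF that] by (simp add: AutoGroup_def)
  have hom: "\<phi> x \<in> hom G0 G0" if "x \<in> carrier G1" for x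
    using cl[OF that] by (simp add: auto_def)
  have closed: "\<phi> x a \<in> carrier G0" if "x \<in> carrier G1" "a \<in> carrier G0" for x a
    using hom[OF that(1)] that(2) by (rule hom_in_carrier)
  have mult: "\<phi> x (a \<otimes>\<^bsub>G0\<^esub> b) = \<phi> x a \<otimes>\<^bsub>G0\<^esub> \<phi> x b"
    if "x \<in> carrier G1" "a \<in> carrier G0" "b \<in> carrier G0" for x a b
    using hom_mult[OF hom] that by blast
  have act: "\<phi> (x \<otimes>\<^bsub>G1\<^esub> y) a = \<phi> x (\<phi> y a)"
    if "x \<in> carrier G1" "y \<in> carrier G1" "a \<in> carrier G0" for x y a
    using \<phi>.hom_mult[OF that(1,2)] cl[OF that(1)] cl[OF that(2)] that(3)
    by (simp add: AutoGroup_def BijGroup_def auto_def compose_def)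
  have one: "\<phi> \<one>\<^bsub>G1\<^esub> a = a" if "a \<in> carrier G0" for a
    using \<phi>.hom_one that by (simp add: AutoGroup_def BijGroup_def)
  show ?thesis
  proof (rule groupI)
    fix p assume "p \<in> carrier (semidirect_product G0 G1 \<phi>)"
    then obtain a x where p: "p = (a, x)" "a \<in> carrier G0" "x \<in> carrier G1"
      by (auto simp: semidirect_product_def)
    let ?y = "inv\<^bsub>G1\<^esub> x"
    have "(\<phi> ?y (inv\<^bsub>G0\<^esub> a), ?y) \<otimes>\<^bsub>semidirect_product G0 G1 \<phi>\<^esub> p = \<one>\<^bsub>semidirect_product G0 G1 \<phi>\<^esub>"
      using p mult[of ?y "inv\<^bsub>G0\<^esub> a" a, symmetric] hom_one[OF hom[of ?y]] G0.is_group
      by (simp add: semidirect_product_def)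
    then show "\<exists>q\<in>carrier (semidirect_product G0 G1 \<phi>).
        q \<otimes>\<^bsub>semidirect_product G0 G1 \<phi>\<^esub> p = \<one>\<^bsub>semidirect_product G0 G1 \<phi>\<^esub>"
      using p closed[of ?y "inv\<^bsub>G0\<^esub> a"] by (intro bexI[of _ "(\<phi> ?y (inv\<^bsub>G0\<^esub> a), ?y)"])
        (simp_all add: semidirect_product_def)
  qed (auto simp: semidirect_product_def closed mult act one G0.m_assoc G1.m_assoc
      simp del: \<phi>.hom_mult \<phi>.hom_one)
qed

definition is_semidirect_product :: "'d monoid \<Rightarrow> 'b monoid \<Rightarrow> 'c monoid \<Rightarrow> bool" where
  "is_semidirect_product H G0 G1 \<longleftrightarrow>
     (\<exists>\<phi> \<in> hom G1 (AutoGroup G0). H \<cong> semidirect_product G0 G1 \<phi>)"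

text \<open>
  A HOL formula cannot quantify over types, so the element types of the semidirect product \<open>H\<close>
  and of its factors \<open>G0\<close>, \<open>G1\<close> are passed as an argument. A theorem that leaves these types as
  type variables speaks about all groups.
\<close>
definition rhodes_prime :: "('d \<times> 'b \<times> 'c) itself \<Rightarrow> 'a monoid \<Rightarrow> bool" where
  "rhodes_prime _ G \<longleftrightarrow> nontrivial_group G \<and>
     (\<forall>(H :: 'd monoid) (G0 :: 'b monoid) (G1 :: 'c monoid).
        group H \<and> group G0 \<and> group G1 \<and> is_semidirect_product H G0 G1 \<and> subquotient G H
        \<longrightarrow> subquotient G G0 \<or> subquotient G G1)"

text \<open>Finiteness of \<open>G0\<close> and \<open>G1\<close> follows from that of \<open>H\<close>.\<close>
definition rhodes_prime_finite :: "('d \<times> 'b \<times> 'c) itself \<Rightarrow> 'a monoid \<Rightarrow> bool" where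
  "rhodes_prime_finite _ G \<longleftrightarrow> nontrivial_group G \<and> finite (carrier G) \<and>
     (\<forall>(H :: 'd monoid) (G0 :: 'b monoid) (G1 :: 'c monoid).
        group H \<and> finite (carrier H) \<and> group G0 \<and> group G1
        \<and> is_semidirect_product H G0 G1 \<and> subquotient G H
        \<longrightarrow> subquotient G G0 \<or> subquotient G G1)"

end

theory Submission
  imports Defs
begin

text \<open>
  A semidirect product \<open>H\<close> of \<open>G0\<close> and \<open>G1\<close> is an extension: it has a projection \<open>p\<close> onto \<open>G1\<close>
  whose kernel is a copy of \<open>G0\<close>. Let \<open>f\<close> map a subgroup \<open>S\<close> of \<open>H\<close> onto the
  simple group \<open>G\<close>. The elements of \<open>S\<close> killed by \<open>p\<close> form a normal subgroup of \<open>S\<close>, so their image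
  under the surjection \<open>f\<close> is normal in \<open>G\<close>, hence is either everything or trivial. In the first
  case \<open>f\<close> already maps a subgroup of the copy of \<open>G0\<close> onto \<open>G\<close>. In the second case \<open>f\<close> takes equal
  values where \<open>p\<close> does, so it factors through the subgroup \<open>p ` S\<close> of \<open>G1\<close>. This dichotomy is
  \<open>subquotient_of_extension\<close>; the statement about finite groups is an instance of it.
\<close>

lemma subquotientI:
  assumes "group G" "subgroup S H" "f \<in> epi (H\<lparr>carrier := S\<rparr>) G"
  shows "subquotient G H"
  using assms iso_refl unfolding subquotient_def by blast

lemma subquotientE:
  assumes "subquotient G H" "group G"
  obtains S f where "subgroup S H" "f \<in> epi (H\<lparr>carrier := S\<rparr>) G"
proof -
  from assms(1) obtain S f and K :: "'a monoid"
    where S: "subgroup S H" and f: "f \<in> epi (H\<lparr>carrier := S\<rparr>) K" and "G \<cong> K"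
    unfolding subquotient_def by blast
  from \<open>G \<cong> K\<close> obtain k where k: "k \<in> iso K G"
    using group.iso_sym[OF assms(2)] unfolding is_iso_def by blast
  have "k \<circ> f \<in> epi (H\<lparr>carrier := S\<rparr>) G"
    using f k by (auto simp: iso_iff_mon_epi intro: epi_compose)
  with S show thesis by (rule that)
qed

text \<open>
  The factorisation \<open>g\<close> of \<open>f\<close> through \<open>p\<close> sends \<open>p s\<close> to \<open>f s\<close>; this does not depend on \<open>s\<close>, since
  two choices differ by an element of the kernel of \<open>p\<close>.
\<close>
lemma epi_factor_through_hom:
  assumes "group S" "group Q" "group G"
    and "p \<in> hom S Q" "f \<in> epi S G" "kernel S Q p \<subseteq> kernel S G f"
  obtains g where "g \<in> epi (Q\<lparr>carrier := p ` carrier S\<rparr>) G"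
proof -
  interpret p: group_hom S Q p
    using assms by (simp add: group_hom_def group_hom_axioms_def)
  interpret f: group_hom S G f
    using assms by (simp add: group_hom_def group_hom_axioms_def epi_def)
  define g where "g = f \<circ> inv_into (carrier S) p"
  have g: "g (p s) = f s" if s: "s \<in> carrier S" for s
  proof -
    define t where "t = inv_into (carrier S) p (p s)"
    have t: "t \<in> carrier S" "p t = p s"
      using s by (auto simp: t_def inv_into_into f_inv_into_f)
    then have "inv\<^bsub>S\<^esub> t \<otimes>\<^bsub>S\<^esub> s \<in> kernel S Q p"
      using s by (simp add: kernel_def p.H.l_inv)
    then have "inv\<^bsub>G\<^esub> f t \<otimes>\<^bsub>G\<^esub> f s = \<one>\<^bsub>G\<^esub>"
      using assms(6) s t by (auto simp: kernel_def dest!: subsetD[of _ _ "inv\<^bsub>S\<^esub> t \<otimes>\<^bsub>S\<^esub> s"])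
    then have "f t = f s"
      using s t by (metis f.H.inv_equality f.H.inv_inv f.H.inv_closed f.hom_closed)
    then show ?thesis by (simp add: g_def t_def)
  qed
  have "g \<in> hom (Q\<lparr>carrier := p ` carrier S\<rparr>) G"
  proof (rule homI)
    fix x y
    assume "x \<in> carrier (Q\<lparr>carrier := p ` carrier S\<rparr>)" "y \<in> carrier (Q\<lparr>carrier := p ` carrier S\<rparr>)"
    then obtain s t where "s \<in> carrier S" "x = p s" "t \<in> carrier S" "y = p t"
      by auto
    then show "g (x \<otimes>\<^bsub>Q\<lparr>carrier := p ` carrier S\<rparr>\<^esub> y) = g x \<otimes>\<^bsub>G\<^esub> g y"
      using g[of "s \<otimes>\<^bsub>S\<^esub> t"] by (simp add: g)
  qed (auto simp: g)
  moreover have "g ` p ` carrier S = carrier G"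
    using assms(5) by (simp add: image_image g epi_def)
  ultimately show thesis
    by (intro that) (simp add: epi_def)
qed

text \<open>
  For \<open>f\<close> from a subgroup \<open>S\<close> of \<open>H\<close> onto \<open>G\<close>, the two disjuncts correspond to the two normal
  subgroups of \<open>G\<close>: either \<open>f\<close> is still onto when restricted to the part of \<open>S\<close> inside the kernel
  of \<open>p\<close>, and composing with \<open>i\<close> moves it to \<open>G0\<close>, or it vanishes there and descends along \<open>p\<close>.
\<close>
lemma subquotient_of_extension:
  assumes "group G0" "group H" "group G1" "group G"
    and i: "i \<in> hom G0 H" and p: "p \<in> hom H G1"
    and ker: "kernel H G1 p \<subseteq> i ` carrier G0"
    and simple: "simple_grp G" and sub: "subquotient G H"
  shows "subquotient G G0 \<or> subquotient G G1"
proof -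
  interpret i: group_hom G0 H i
    using assms by (simp add: group_hom_def group_hom_axioms_def)
  interpret p: group_hom H G1 p
    using assms by (simp add: group_hom_def group_hom_axioms_def)
  obtain S f where S: "subgroup S H" and f: "f \<in> epi (H\<lparr>carrier := S\<rparr>) G"
    using subquotientE[OF sub \<open>group G\<close>] .
  interpret S: subgroup S H by fact
  let ?S = "H\<lparr>carrier := S\<rparr>"
  have grpS: "group ?S"
    using S \<open>group H\<close> by (rule subgroup.subgroup_is_group)
  have pS: "p \<in> hom ?S G1"
    using p S.subset by (auto simp: hom_def Pi_iff)
  interpret pS: group_hom ?S G1 p
    using grpS \<open>group G1\<close> pS by (simp add: group_hom_def group_hom_axioms_def)
  let ?N = "kernel ?S G1 p"
  have N: "?N = S \<inter> kernel H G1 p"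
    using S.subset by (auto simp: kernel_def)
  have "f ` ?N \<lhd> G"
    using normal.surj_hom_normal_subgroup[OF pS.normal_kernel, of G f] grpS \<open>group G\<close> f
    by (simp add: epi_def group_hom_def group_hom_axioms_def)
  with simple consider (trivial) "f ` ?N = {\<one>\<^bsub>G\<^esub>}" | (all) "f ` ?N = carrier G"
    unfolding simple_grp_def by blast
  then show ?thesis
  proof cases
    case all
    let ?A = "{a \<in> carrier G0. i a \<in> S}"
    have A: "subgroup ?A G0"
      by (rule i.G.subgroupI) (auto simp: i.hom_mult intro: exI[of _ "\<one>\<^bsub>G0\<^esub>"])
    have "f \<circ> i \<in> hom (G0\<lparr>carrier := ?A\<rparr>) G"
      using i f by (intro hom_compose[of _ _ ?S]) (auto simp: hom_def epi_def)
    moreover have "(f \<circ> i) ` ?A = carrier G"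
    proof
      show "(f \<circ> i) ` ?A \<subseteq> carrier G"
        using f by (auto simp: epi_def)
      show "carrier G \<subseteq> (f \<circ> i) ` ?A"
        unfolding all[symmetric] N using ker by fastforce
    qed
    ultimately have "f \<circ> i \<in> epi (G0\<lparr>carrier := ?A\<rparr>) G"
      by (simp add: epi_def)
    with \<open>group G\<close> A have "subquotient G G0" by (rule subquotientI)
    then show ?thesis ..
  next
    case trivial
    then have "?N \<subseteq> kernel ?S G f"
      by (auto simp: kernel_def)
    with grpS \<open>group G1\<close> \<open>group G\<close> pS f
    obtain g where "g \<in> epi (G1\<lparr>carrier := p ` carrier ?S\<rparr>) G"
      by (rule epi_factor_through_hom)
    moreover have "subgroup (p ` carrier ?S) G1"
      using p.subgroup_img_is_subgroup[OF S] by simp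
    ultimately have "subquotient G G1"
      using \<open>group G\<close> by (blast intro: subquotientI)
    then show ?thesis ..
  qed
qed

lemma semidirect_product_extension:
  assumes "group H" "group G0" "group G1" "is_semidirect_product H G0 G1"
  obtains i p where "i \<in> hom G0 H" "p \<in> hom H G1" "kernel H G1 p \<subseteq> i ` carrier G0"
proof -
  from assms(4) obtain \<phi> h where \<phi>: "\<phi> \<in> hom G1 (AutoGroup G0)"
    and h: "h \<in> iso H (semidirect_product G0 G1 \<phi>)"
    unfolding is_semidirect_product_def is_iso_def by blast
  let ?P = "semidirect_product G0 G1 \<phi>"
  let ?k = "inv_into (carrier H) h" and ?j = "\<lambda>a. (a, \<one>\<^bsub>G1\<^esub>)"
  interpret G0: group G0 by fact
  interpret G1: group G1 by fact
  interpret \<phi>: group_hom G1 "AutoGroup G0" \<phi>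
    using \<phi> G0.AutoGroup \<open>group G1\<close> by (simp add: group_hom_def group_hom_axioms_def)
  have "\<phi> \<one>\<^bsub>G1\<^esub> a = a" if "a \<in> carrier G0" for a
    using \<phi>.hom_one that by (simp add: AutoGroup_def BijGroup_def)
  then have j: "?j \<in> hom G0 ?P"
    by (auto simp: hom_def semidirect_product_def)
  have "?k \<in> iso ?P H"
    using \<open>group H\<close> h by (rule group.iso_set_sym)
  with j have i: "?k \<circ> ?j \<in> hom G0 H"
    by (auto intro: hom_compose simp: iso_def)
  have "snd \<in> hom ?P G1"
    by (auto simp: hom_def semidirect_product_def)
  with h have p: "snd \<circ> h \<in> hom H G1"
    by (auto intro: hom_compose simp: iso_def)
  have "kernel H G1 (snd \<circ> h) \<subseteq> (?k \<circ> ?j) ` carrier G0"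
  proof
    fix x assume "x \<in> kernel H G1 (snd \<circ> h)"
    then have x: "x \<in> carrier H" and "snd (h x) = \<one>\<^bsub>G1\<^esub>"
      by (auto simp: kernel_def)
    moreover have "h x \<in> carrier ?P"
      using h x by (auto simp: iso_def bij_betw_def)
    ultimately obtain a where a: "a \<in> carrier G0" and hx: "h x = ?j a"
      by (auto simp: semidirect_product_def)
    have "?k (h x) = x"
      using h x by (simp add: iso_def bij_betw_def)
    with a hx show "x \<in> (?k \<circ> ?j) ` carrier G0"
      by (auto intro!: image_eqI[of _ _ a])
  qed
  with i p show thesis by (rule that)
qed

theorem proposition6p4:
  shows "(\<forall>G :: 'a monoid. nontrivial_group G \<and> simple_grp G
            \<longrightarrow> rhodes_prime TYPE('d \<times> 'b \<times> 'c) G)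
       \<and> (\<forall>G :: 'a monoid. nontrivial_group G \<and> simple_grp G \<and> finite (carrier G)
            \<longrightarrow> rhodes_prime_finite TYPE('d \<times> 'b \<times> 'c) G)"
proof -
  have "subquotient G G0 \<or> subquotient G G1"
    if simple: "simple_grp G" and grp: "group H" "group G0" "group G1"
      and prod: "is_semidirect_product H G0 G1" and sub: "subquotient G H"
    for G :: "'a monoid" and H :: "'d monoid" and G0 :: "'b monoid" and G1 :: "'c monoid"
  proof -
    have "group G" using simple by (simp add: simple_grp_def)
    obtain i p where "i \<in> hom G0 H" "p \<in> hom H G1" "kernel H G1 p \<subseteq> i ` carrier G0"
      using semidirect_product_extension[OF grp prod] .
    with grp \<open>group G\<close> simple sub show ?thesis by (intro subquotient_of_extension)
  qed
  then show ?thesis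
    unfolding rhodes_prime_def rhodes_prime_finite_def by blast
qed

end
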